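(* Let $r$ be the unique real number with $7r^5-10r^4-20r^3-4=0$ (so $r\approx2.558$). Then: (1) For $t\in\mathbb{Q}$, $t\neq2$, the field $K_t$ is totally real if and only if $2<t<r$. (2) There exist infinitely many rational numbers $t$ with $2<t<r$ such that the corresponding fields $K_t$ are pairwise distinct.
   Context: For $t\in\mathbb{Q}$, $t\neq2$, put $u=\frac{3t^2-2t+2}{t^2+t-1}$, $v=\frac{t^5-5t^4+10t^3-20t^2+15t-7}{(t-2)(t^2+t-1)^2}$, $w=\frac{-3t^5+10t^4-20t^3+20t^2-20t+6}{(t-2)(t^2+t-1)^2}$, $f_t=X^6+uX^5+vX^4+wX^3+vX^2+uX+1\in\mathbb{Q}[X]$, and let $K_t\subset\overline{\mathbb{Q}}$ be the splitting field of $f_t$ over $\mathbb{Q}$. *)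

theory Defs
  imports "HOL-Computational_Algebra.Polynomial" Complex_Main
begin

definition u_t :: "rat \<Rightarrow> rat" where
  "u_t t = (3*t^2 - 2*t + 2) / (t^2 + t - 1)"

definition v_t :: "rat \<Rightarrow> rat" where
  "v_t t = (t^5 - 5*t^4 + 10*t^3 - 20*t^2 + 15*t - 7) / ((t - 2) * (t^2 + t - 1)^2)"

definition w_t :: "rat \<Rightarrow> rat" where
  "w_t t = (-3*t^5 + 10*t^4 - 20*t^3 + 20*t^2 - 20*t + 6) / ((t - 2) * (t^2 + t - 1)^2)"

definition f_t :: "rat \<Rightarrow> rat poly" where
  "f_t t = [:1, u_t t, v_t t, w_t t, v_t t, u_t t, 1:]"

text \<open>Subfields of the complex numbers (which contain an algebraic closure of Q).\<close>
definition is_subfield :: "complex set \<Rightarrow> bool" where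
  "is_subfield F \<longleftrightarrow> 0 \<in> F \<and> 1 \<in> F \<and>
     (\<forall>x\<in>F. \<forall>y\<in>F. x + y \<in> F \<and> x * y \<in> F) \<and>
     (\<forall>x\<in>F. - x \<in> F) \<and> (\<forall>x\<in>F. x \<noteq> 0 \<longrightarrow> inverse x \<in> F)"

text \<open>Subfield of C generated (over Q, the prime field) by a set A.\<close>
definition gen_field :: "complex set \<Rightarrow> complex set" where
  "gen_field A = \<Inter>{F. is_subfield F \<and> A \<subseteq> F}"

definition splitting_field :: "rat poly \<Rightarrow> complex set" where
  "splitting_field p = gen_field {z. poly (map_poly of_rat p) z = 0}"

definition K_t :: "rat \<Rightarrow> complex set" where
  "K_t t = splitting_field (f_t t)"

definition totally_real :: "complex set \<Rightarrow> bool" where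
  "totally_real K \<longleftrightarrow>
     (\<forall>\<sigma> :: complex \<Rightarrow> complex.
        (\<forall>x\<in>K. \<forall>y\<in>K. \<sigma> (x + y) = \<sigma> x + \<sigma> y \<and> \<sigma> (x * y) = \<sigma> x * \<sigma> y) \<and> \<sigma> 1 = 1
        \<longrightarrow> (\<forall>x\<in>K. \<sigma> x \<in> \<real>))"

end

theory Submission
  imports Defs "HOL-Computational_Algebra.Primes"
    "HOL-Computational_Algebra.Fundamental_Theorem_Algebra"
begin

text \<open>
  The polynomial f is reciprocal, so with y = x + 1/x it becomes a cubic G(y), and all roots of f are
  real iff all roots of G are real of absolute value at least 2. Writing d = t^2 + t - 1 and P for the
  quintic of the theorem, G(-2) = -(t-2)^4/d^2 and G(2) = P(t)/((t-2)d^2), while the discriminant of G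
  is -(t-2)P(t) times a square. Since G(-2) < 0, real roots of absolute value at least 2 force
  G(2) \<le> 0. Conversely, if (t-2)P(t) < 0, then G has three real roots, and as their sum is
  -2 - (t-2)^2/d, the signs of G(2) and G(-2) place one root above 2 and two roots below -2.

  For the second part, G(2)G(-2) is the square of the product of the x_i - 1/x_i, where x_i + 1/x_i
  runs through the three roots of G, so the field contains a square root of -(t-2)P(t). For a prime p > 5 and
  t = 2 + p/(2p+1) this number has p-adic valuation 1, whereas a finite-dimensional extension of the
  rationals contains square roots of only finitely many square classes.
\<close>

section \<open>Subfields of the complex numbers as rational vector spaces\<close>

interpretation Q: vector_space "\<lambda>(q::rat) (z::complex). of_rat q * z"
  by unfold_locales (auto simp: algebra_simps of_rat_add of_rat_mult)

lemma is_subfieldD: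
  assumes "is_subfield F"
  shows "0 \<in> F" "1 \<in> F" "\<And>x y. x \<in> F \<Longrightarrow> y \<in> F \<Longrightarrow> x + y \<in> F"
    "\<And>x y. x \<in> F \<Longrightarrow> y \<in> F \<Longrightarrow> x * y \<in> F" "\<And>x. x \<in> F \<Longrightarrow> - x \<in> F"
    "\<And>x. x \<in> F \<Longrightarrow> inverse x \<in> F"
  using assms unfolding is_subfield_def by (force | metis inverse_zero)+

lemma is_subfield_diff: "is_subfield F \<Longrightarrow> x \<in> F \<Longrightarrow> y \<in> F \<Longrightarrow> x - y \<in> F"
  using is_subfieldD(3,5)[of F] by (metis diff_conv_add_uminus)

lemma is_subfield_divide: "is_subfield F \<Longrightarrow> x \<in> F \<Longrightarrow> y \<in> F \<Longrightarrow> x / y \<in> F"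
  using is_subfieldD(4,6)[of F] by (metis divide_inverse)

lemma is_subfield_of_nat: "is_subfield F \<Longrightarrow> of_nat n \<in> F"
  by (induction n) (auto intro: is_subfieldD)

lemma is_subfield_of_int: "is_subfield F \<Longrightarrow> of_int k \<in> F"
  by (cases k) (auto intro: is_subfieldD(5) is_subfield_of_nat simp del: of_nat_Suc)

lemma is_subfield_of_rat: "is_subfield F \<Longrightarrow> of_rat q \<in> F"
  by (cases q) (auto simp: of_rat_rat intro!: is_subfield_divide is_subfield_of_int)

lemma is_subfield_Rats: "is_subfield \<rat>"
  unfolding is_subfield_def by auto

lemma gen_field_least: "is_subfield F \<Longrightarrow> A \<subseteq> F \<Longrightarrow> gen_field A \<subseteq> F"
  unfolding gen_field_def by blast

lemma gen_field_superset: "A \<subseteq> gen_field A"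
  unfolding gen_field_def by blast

lemma is_subfield_gen_field: "is_subfield (gen_field A)"
  unfolding gen_field_def is_subfield_def by auto

lemma subspace_subfield: "is_subfield F \<Longrightarrow> Q.subspace F"
  by (auto simp: Q.subspace_def intro: is_subfieldD is_subfield_of_rat)

text \<open>Serves together with \<open>Q.span_minimal\<close>: that multiplication by
  \<open>a\<close> maps a span into \<open>W\<close> then has to be checked on generators
  only.\<close>

lemma subspace_mult_vimage:
  assumes "Q.subspace W"
  shows "Q.subspace {w. a * w \<in> W}"
proof (rule Q.subspaceI)
  show "0 \<in> {w. a * w \<in> W}" using Q.subspace_0[OF assms] by simp
next
  fix v w assume "v \<in> {w. a * w \<in> W}" "w \<in> {w. a * w \<in> W}"
  then show "v + w \<in> {w. a * w \<in> W}"
    using Q.subspace_add[OF assms] by (simp add: distrib_left)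
next
  fix c w assume "w \<in> {w. a * w \<in> W}"
  then have "of_rat c * (a * w) \<in> W" using Q.subspace_scale[OF assms] by simp
  then show "of_rat c * w \<in> {w. a * w \<in> W}" by (simp add: mult.left_commute)
qed

section \<open>Finite-dimensional subfields\<close>

text \<open>Multiplication by \<open>z\<close> is injective, so it carries a basis of
  \<open>W\<close> to an independent set of the same size inside \<open>W\<close>. By counting, that
  set spans \<open>W\<close> as well, and in particular 1, which is therefore \<open>z\<close> times
  an element of \<open>W\<close>.\<close>

lemma finite_dim_domain_inverse:
  assumes "Q.subspace W" "1 \<in> W" "finite B" "W \<subseteq> Q.span B"
    and mult: "\<And>x y. x \<in> W \<Longrightarrow> y \<in> W \<Longrightarrow> x * y \<in> W"
    and z: "z \<in> W" "z \<noteq> 0"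
  shows "inverse z \<in> W"
proof -
  obtain E where E: "E \<subseteq> W" "Q.independent E" "W \<subseteq> Q.span E"
    using Q.maximal_independent_subset by blast
  have finE: "finite E"
    using Q.independent_span_bound[OF assms(3) E(2)] E(1) assms(4) by blast
  let ?m = "\<lambda>x. z * x"
  interpret L: Vector_Spaces.linear "\<lambda>(q::rat) (z::complex). of_rat q * z" "\<lambda>(q::rat) (z::complex). of_rat q * z" ?m
    by unfold_locales (auto simp: algebra_simps)
  have ind: "Q.independent (?m ` E)"
    using L.independent_injective_image[OF E(2)] z by (auto simp: inj_on_def)
  have card: "card (?m ` E) = card E"
    using z by (intro card_image) (auto simp: inj_on_def)
  have "1 \<in> Q.span (?m ` E)"
  proof (rule ccontr)
    assume *: "1 \<notin> Q.span (?m ` E)"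
    then have "Q.independent (insert 1 (?m ` E))"
      using ind Q.independent_insertI by blast
    moreover have "insert 1 (?m ` E) \<subseteq> Q.span E"
      using E(1,3) assms(2) mult z by auto
    ultimately have "card (insert 1 (?m ` E)) \<le> card E"
      using Q.independent_span_bound[OF finE] by blast
    moreover have "1 \<notin> ?m ` E" using * Q.span_base by blast
    ultimately show False using finE card by simp
  qed
  then obtain v where v: "v \<in> Q.span E" "1 = z * v"
    unfolding L.span_image by blast
  have "v \<in> W" using v(1) Q.span_minimal[OF E(1) assms(1)] by blast
  moreover have "inverse z = v" using v(2) z by (simp add: field_simps)
  ultimately show ?thesis by simp
qed

text \<open>The products \<open>f * x ^ i\<close> with \<open>f\<close> in \<open>F\<close> and
  \<open>i < n\<close> span a ring, because the relation rewrites \<open>x ^ n\<close>. Inverses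
  come from finite dimension instead of irreducibility, so any monic relation will do.\<close>

lemma adjoin_algebraic:
  assumes F: "is_subfield F" "finite B" "F \<subseteq> Q.span B"
    and x: "x ^ n = (\<Sum>i<n. of_rat (c i) * x ^ i)" and n: "0 < n"
  obtains F' B' where "is_subfield F'" "F \<subseteq> F'" "x \<in> F'" "finite B'" "F' \<subseteq> Q.span B'"
proof -
  define G where "G = (\<lambda>(f, i). f * x ^ i) ` (F \<times> {..<n})"
  define W where "W = Q.span G"
  define B' where "B' = (\<lambda>(b, i). x ^ i * b) ` (B \<times> {..<n})"
  have G: "f * x ^ i \<in> W" if "f \<in> F" "i < n" for f i
    unfolding W_def by (rule Q.span_base) (use that in \<open>auto simp: G_def\<close>)
  have linear_mult: "Q.subspace {w. a * w \<in> W}" for a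
    unfolding W_def by (intro subspace_mult_vimage Q.subspace_span)
  have multF: "f * w \<in> W" if f: "f \<in> F" and w: "w \<in> W" for f w
  proof -
    have "G \<subseteq> {w. f * w \<in> W}"
    proof
      fix g assume "g \<in> G"
      then obtain h i where g: "g = h * x ^ i" "h \<in> F" "i < n" by (auto simp: G_def)
      have "(f * h) * x ^ i \<in> W" using f g by (intro G is_subfieldD(4)[OF F(1)])
      then show "g \<in> {w. f * w \<in> W}" by (simp add: g(1) mult.assoc)
    qed
    then show ?thesis using Q.span_minimal[OF _ linear_mult] w unfolding W_def by blast
  qed
  have xn: "x ^ n \<in> W"
    unfolding x W_def by (intro Q.span_sum Q.span_scale) (use G[of 1, OF is_subfieldD(2)[OF F(1)]] in \<open>simp add: W_def\<close>)
  have multx: "x * w \<in> W" if w: "w \<in> W" for w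
  proof -
    have "G \<subseteq> {w. x * w \<in> W}"
    proof
      fix g assume "g \<in> G"
      then obtain h i where g: "g = h * x ^ i" "h \<in> F" "i < n" by (auto simp: G_def)
      have "x * g = h * x ^ Suc i" by (simp add: g(1))
      moreover have "h * x ^ Suc i \<in> W"
      \<comment> \<open>Only the top power leaves the range \<open>i < n\<close>; the relation
        brings it back into \<open>W\<close>.\<close>
      proof (cases "Suc i = n")
        case True
        then show ?thesis using multF[OF g(2) xn] by (metis)
      next
        case False
        then show ?thesis using g by (intro G) auto
      qed
      ultimately show "g \<in> {w. x * w \<in> W}" by (simp only: mem_Collect_eq)
    qed
    then show ?thesis using Q.span_minimal[OF _ linear_mult] w unfolding W_def by blast
  qed
  have multpow: "x ^ i * w \<in> W" if "w \<in> W" for i w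
    using that by (induction i) (auto simp: mult.assoc intro: multx)
  have mult: "v * w \<in> W" if v: "v \<in> W" and w: "w \<in> W" for v w
  proof -
    have "G \<subseteq> {v. w * v \<in> W}"
    proof
      fix g assume "g \<in> G"
      then obtain h i where g: "g = h * x ^ i" "h \<in> F" "i < n" by (auto simp: G_def)
      have "h * (x ^ i * w) \<in> W" using g w by (intro multF multpow)
      then show "g \<in> {v. w * v \<in> W}" by (simp add: g(1) ac_simps)
    qed
    then have "w * v \<in> W" using Q.span_minimal[OF _ linear_mult] v unfolding W_def by blast
    then show ?thesis by (simp add: mult.commute)
  qed
  have one: "1 \<in> W" using G[OF is_subfieldD(2)[OF F(1)] n] by simp
  have FW: "F \<subseteq> W" using G[OF _ n] by auto
  have xW: "x \<in> W" using multx[OF one] by simp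
  have sub: "Q.subspace W" unfolding W_def by simp
  \<comment> \<open>The coefficients \<open>h\<close> run through the infinite set \<open>F\<close>;
    expanding them in \<open>B\<close> leaves the finite generating set \<open>B'\<close>.\<close>
  have "G \<subseteq> Q.span B'"
  proof
    fix g assume "g \<in> G"
    then obtain h i where g: "g = h * x ^ i" "h \<in> F" "i < n" by (auto simp: G_def)
    have "B \<subseteq> {h. x ^ i * h \<in> Q.span B'}"
      using g(3) by (auto simp: B'_def intro!: Q.span_base)
    then have "Q.span B \<subseteq> {h. x ^ i * h \<in> Q.span B'}"
      by (intro Q.span_minimal subspace_mult_vimage Q.subspace_span)
    then show "g \<in> Q.span B'" using g F(3) by (auto simp: mult.commute)
  qed
  then have WB: "W \<subseteq> Q.span B'" unfolding W_def by (intro Q.span_minimal) auto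
  have finB': "finite B'" using F(2) by (simp add: B'_def)
  have inv: "inverse z \<in> W" if "z \<in> W" "z \<noteq> 0" for z
    using finite_dim_domain_inverse[OF sub one finB' WB mult] that by blast
  have "is_subfield W"
    unfolding is_subfield_def
    by (simp add: one mult inv Q.subspace_0[OF sub] Q.subspace_add[OF sub] Q.subspace_neg[OF sub])
  then show thesis using that FW xW finB' WB by blast
qed

text \<open>The elements are adjoined to the rationals one at a time. They share one relation
  because \<open>A\<close> will be the set of roots of a single monic polynomial.\<close>

lemma algebraic_in_finite_dim_subfield:
  assumes "finite A" and n: "0 < n"
    and "\<And>x. x \<in> A \<Longrightarrow> x ^ n = (\<Sum>i<n. of_rat (c i) * x ^ i)"
  shows "\<exists>F B. is_subfield F \<and> A \<subseteq> F \<and> finite B \<and> F \<subseteq> Q.span B"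
  using assms(1,3)
proof (induction A rule: finite_induct)
  case empty
  have "\<rat> \<subseteq> Q.span {1}"
    by (auto simp: Rats_def Q.span_singleton)
  then show ?case using is_subfield_Rats by blast
next
  case (insert a A)
  then obtain F B where F: "is_subfield F" "A \<subseteq> F" "finite B" "F \<subseteq> Q.span B" by auto
  obtain F' B' where "is_subfield F'" "F \<subseteq> F'" "a \<in> F'" "finite B'" "F' \<subseteq> Q.span B'"
    using adjoin_algebraic[OF F(1,3,4) insert.prems[of a] n] by blast
  then show ?case using F(2) by blast
qed

section \<open>Square roots of rationals in a finite-dimensional extension\<close>

text \<open>Inverses arise by rationalizing with the conjugate \<open>x - y * a\<close>. It cannot
  vanish for a nonzero element, since otherwise \<open>a = x / y\<close> would lie in
  \<open>F\<close>.\<close>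

lemma is_subfield_adjoin_sqrt:
  assumes F: "is_subfield F" and a: "a ^ 2 \<in> F" "a \<notin> F"
  shows "is_subfield {x + y * a |x y. x \<in> F \<and> y \<in> F}" (is "is_subfield ?L")
  unfolding is_subfield_def
proof (intro conjI ballI impI)
  note D = is_subfieldD[OF F]
  show "0 \<in> ?L" "1 \<in> ?L"
    using D(1,2) by force+
  fix z assume "z \<in> ?L"
  then obtain x y where z: "z = x + y * a" and xy: "x \<in> F" "y \<in> F" by blast
  show "- z \<in> ?L"
    unfolding z by (rule CollectI, rule exI[of _ "-x"], rule exI[of _ "-y"]) (use D(5) xy in auto)
  { fix z' assume "z' \<in> ?L"
    then obtain x' y' where z': "z' = x' + y' * a" and xy': "x' \<in> F" "y' \<in> F" by blast
    have "z + z' = (x + x') + (y + y') * a" by (simp add: z z' algebra_simps)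
    then show "z + z' \<in> ?L" using D(3) xy xy' by blast
    have "z * z' = (x * x' + y * y' * a ^ 2) + (x * y' + y * x') * a"
      by (simp add: z z' algebra_simps power2_eq_square)
    moreover have "x * x' + y * y' * a ^ 2 \<in> F" "x * y' + y * x' \<in> F"
      using xy xy' a(1) by (simp_all add: D(3,4))
    ultimately show "z * z' \<in> ?L" by blast }
  assume nz: "z \<noteq> 0"
  have "x - y * a \<noteq> 0"
  proof
    assume *: "x - y * a = 0"
    then have "y \<noteq> 0" using z nz by auto
    then have "a = x / y" using * by (simp add: field_simps)
    then show False using a(2) is_subfield_divide[OF F] xy by blast
  qed
  then have "inverse z = x / (x * x - y * y * a ^ 2) + (- y / (x * x - y * y * a ^ 2)) * a"
  proof -
    have *: "x * x - y * y * a ^ 2 = z * (x - y * a)" by (simp add: z algebra_simps power2_eq_square)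
    show ?thesis unfolding * using nz \<open>x - y * a \<noteq> 0\<close>
      by (simp add: divide_simps)
  qed
  moreover have "x * x - y * y * a ^ 2 \<in> F"
    using xy a(1) by (intro is_subfield_diff[OF F]) (simp_all add: D(4))
  then have "x / (x * x - y * y * a ^ 2) \<in> F" "- y / (x * x - y * y * a ^ 2) \<in> F"
    using xy by (auto intro!: is_subfield_divide[OF F] D(5))
  ultimately show "inverse z \<in> ?L" by blast
qed

text \<open>Kummer theory for square roots, by induction on \<open>A\<close>. The point of the
  conclusion is that a finite \<open>A\<close> has only finitely many subset products, so the square
  roots of rationals in \<open>L\<close> fall into finitely many classes modulo rational
  factors.\<close>

lemma multiquadratic_subfield:
  assumes "finite A" "\<And>a. a \<in> A \<Longrightarrow> a ^ 2 \<in> \<rat>"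
  shows "\<exists>L. is_subfield L \<and> A \<subseteq> L \<and>
    (\<forall>s\<in>L. s ^ 2 \<in> \<rat> \<longrightarrow> (\<exists>q\<in>\<rat>. \<exists>I\<subseteq>A. s = q * \<Prod>I))"
  using assms
proof (induction A rule: finite_induct)
  case empty
  show ?case by (rule exI[of _ "\<rat>"]) (use is_subfield_Rats in auto)
next
  case (insert a A)
  then obtain L where L: "is_subfield L" "A \<subseteq> L"
    and pure: "\<And>s. s \<in> L \<Longrightarrow> s ^ 2 \<in> \<rat> \<Longrightarrow> \<exists>q\<in>\<rat>. \<exists>I\<subseteq>A. s = q * \<Prod>I"
    by auto
  note D = is_subfieldD[OF L(1)]
  have ratL: "\<rat> \<subseteq> L" using is_subfield_of_rat[OF L(1)] by (auto simp: Rats_def)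
  have a2: "a ^ 2 \<in> \<rat>" using insert.prems by simp
  show ?case
  proof (cases "a \<in> L")
    case True
    have "\<exists>q\<in>\<rat>. \<exists>I\<subseteq>insert a A. s = q * \<Prod>I" if "s \<in> L" "s ^ 2 \<in> \<rat>" for s
      using pure[OF that] by (meson subset_insertI2)
    then show ?thesis using L(1,2) True by (intro exI[of _ L]) simp
  next
    case False
    define M where "M = {x + y * a |x y. x \<in> L \<and> y \<in> L}"
    have "a ^ 2 \<in> L" using a2 ratL by (rule subsetD[rotated])
    then have M: "is_subfield M"
      unfolding M_def using False by (rule is_subfield_adjoin_sqrt[OF L(1)])
    have "x \<in> M" if "x \<in> L" for x
      unfolding M_def using that D(1) by force
    moreover have "a \<in> M" unfolding M_def using D(1,2) by force
    ultimately have sub: "insert a A \<subseteq> M" using L(2) by blast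
    have "\<exists>q\<in>\<rat>. \<exists>I\<subseteq>insert a A. s = q * \<Prod>I" if s: "s \<in> M" "s ^ 2 \<in> \<rat>" for s
    proof -
      obtain x y where xy: "s = x + y * a" "x \<in> L" "y \<in> L" using s(1) unfolding M_def by blast
      have s2: "s ^ 2 = x ^ 2 + y ^ 2 * a ^ 2 + (2 * x * y) * a"
        by (simp add: xy(1) algebra_simps power2_eq_square)
      \<comment> \<open>A nonzero cross term \<open>2 * x * y * a\<close> would put \<open>a\<close>
        into \<open>L\<close>.\<close>
      have "x = 0 \<or> y = 0"
      proof (rule ccontr)
        assume "\<not> (x = 0 \<or> y = 0)"
        then have "a = (s ^ 2 - (x ^ 2 + y ^ 2 * a ^ 2)) / (2 * x * y)"
          by (simp add: s2)
        moreover have "\<dots> \<in> L"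
        proof -
          have "2 \<in> L" using is_subfield_of_nat[OF L(1), of 2] by simp
          then have "2 * x * y \<in> L" using xy D(4) by blast
          moreover have "a ^ 2 \<in> L" using a2 ratL by blast
          then have "x ^ 2 + y ^ 2 * a ^ 2 \<in> L"
            using D(3,4) xy by (simp add: power2_eq_square)
          moreover have "s ^ 2 \<in> L" using s(2) ratL by blast
          ultimately show ?thesis by (intro is_subfield_divide[OF L(1)] is_subfield_diff[OF L(1)])
        qed
        ultimately show False using False by simp
      qed
      then show ?thesis
      proof
        assume "y = 0"
        then show ?thesis using pure[of s] s xy by auto
      next
        assume x: "x = 0"
        \<comment> \<open>Here \<open>s = y * a\<close>. The product
          \<open>s * a = y * a ^ 2\<close> lies in \<open>L\<close> and has a rational square, so
          the induction hypothesis applies to it; dividing by \<open>a\<close> again adds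
          \<open>a\<close> to the subset.\<close>
        have "y * a ^ 2 \<in> L" using xy(3) a2 ratL D(4) by blast
        moreover have "(y * a ^ 2) ^ 2 = s ^ 2 * a ^ 2"
          by (simp add: xy(1) x power2_eq_square)
        ultimately obtain q I where q: "q \<in> \<rat>" "I \<subseteq> A" "y * a ^ 2 = q * \<Prod>I"
          using pure[of "y * a ^ 2"] s(2) a2 by (metis Rats_mult)
        have "a \<noteq> 0" using False D(1) by auto
        then have "s = (q / a ^ 2) * (a * \<Prod>I)"
          using q(3) by (simp add: xy(1) x field_simps power2_eq_square)
        moreover have "a * \<Prod>I = \<Prod>(insert a I)"
          using q(2) insert.hyps finite_subset by (subst prod.insert) auto
        ultimately show ?thesis using q a2 by (metis Rats_divide insert_mono)
      qed
    qed
    then show ?thesis using M sub by (intro exI[of _ M]) simp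
  qed
qed

text \<open>A maximal independent set \<open>A\<close> of elements of \<open>V\<close> with rational
  square is finite. All such elements lie in its span, hence in the field built from
  \<open>A\<close>, where the subset products of \<open>A\<close> represent them.\<close>

lemma finite_square_classes:
  assumes "finite B" "V \<subseteq> Q.span B"
  obtains C where "finite C" "\<And>s. s \<in> V \<Longrightarrow> s ^ 2 \<in> \<rat> \<Longrightarrow> \<exists>q\<in>\<rat>. \<exists>c\<in>C. s = q * c"
proof -
  define S where "S = {s \<in> V. s ^ 2 \<in> \<rat>}"
  obtain A where A: "A \<subseteq> S" "Q.independent A" "S \<subseteq> Q.span A"
    using Q.maximal_independent_subset by blast
  have fin: "finite A"
    using Q.independent_span_bound[OF assms(1) A(2)] A(1) assms(2) unfolding S_def by blast
  then obtain L where L: "is_subfield L" "A \<subseteq> L"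
    "\<forall>s\<in>L. s ^ 2 \<in> \<rat> \<longrightarrow> (\<exists>q\<in>\<rat>. \<exists>I\<subseteq>A. s = q * \<Prod>I)"
    using multiquadratic_subfield[of A] A(1) unfolding S_def by blast
  have "S \<subseteq> L" using A(3) Q.span_minimal[OF L(2) subspace_subfield[OF L(1)]] by blast
  then have "\<exists>q\<in>\<rat>. \<exists>c\<in>(\<lambda>I. \<Prod>I) ` Pow A. s = q * c" if "s \<in> V" "s ^ 2 \<in> \<rat>" for s
    using L(3) that unfolding S_def by blast
  then show thesis using fin by (intro that[of "(\<lambda>I. \<Prod>I) ` Pow A"]) auto
qed

section \<open>Total reality of a splitting field\<close>

lemma root_in_splitting_field: "poly (map_poly of_rat p) z = 0 \<Longrightarrow> z \<in> splitting_field p"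
  unfolding splitting_field_def
  using gen_field_superset[of "{z. poly (map_poly of_rat p) z = 0}"] by (simp add: subset_iff)

text \<open>The identity is one of the embeddings, which gives one direction. Conversely, an
  embedding fixes the rationals and so sends roots of \<open>p\<close> to roots of \<open>p\<close>;
  the elements with real image form a subfield that contains all roots, hence the whole splitting
  field.\<close>

lemma totally_real_splitting_field_iff:
  "totally_real (splitting_field p) \<longleftrightarrow> (\<forall>z::complex. poly (map_poly of_rat p) z = 0 \<longrightarrow> z \<in> \<real>)"
    (is "_ \<longleftrightarrow> ?R")
proof
  assume "totally_real (splitting_field p)"
  then have "\<forall>x\<in>splitting_field p. x \<in> \<real>"
    unfolding totally_real_def by (drule_tac spec[of _ "\<lambda>x. x"]) simp
  then show ?R using root_in_splitting_field by simp
next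
  assume R: ?R
  let ?K = "splitting_field p"
  have K: "is_subfield ?K" unfolding splitting_field_def by (rule is_subfield_gen_field)
  note D = is_subfieldD[OF K]
  show "totally_real ?K"
    unfolding totally_real_def
  proof (intro allI impI)
    fix \<sigma> :: "complex \<Rightarrow> complex"
    assume "(\<forall>x\<in>?K. \<forall>y\<in>?K. \<sigma> (x + y) = \<sigma> x + \<sigma> y \<and> \<sigma> (x * y) = \<sigma> x * \<sigma> y) \<and> \<sigma> 1 = 1"
    then have add: "\<And>x y. x \<in> ?K \<Longrightarrow> y \<in> ?K \<Longrightarrow> \<sigma> (x + y) = \<sigma> x + \<sigma> y"
      and mult: "\<And>x y. x \<in> ?K \<Longrightarrow> y \<in> ?K \<Longrightarrow> \<sigma> (x * y) = \<sigma> x * \<sigma> y"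
      and one: "\<sigma> 1 = 1" by auto
    have zero: "\<sigma> 0 = 0" using add[of 0 0] D(1) by simp
    have neg: "\<sigma> (- x) = - \<sigma> x" if "x \<in> ?K" for x
      using add[OF that D(5)[OF that]] zero by (simp add: eq_neg_iff_add_eq_0 add.commute)
    have inv: "\<sigma> (inverse x) = inverse (\<sigma> x)" if "x \<in> ?K" for x
    proof (cases "x = 0")
      case False
      then have "\<sigma> x * \<sigma> (inverse x) = 1" using mult[OF that D(6)[OF that]] one by simp
      then show ?thesis by (metis inverse_unique)
    qed (simp add: zero)
    have nat: "\<sigma> (of_nat n) = of_nat n" for n
      by (induction n) (simp_all add: zero one add D is_subfield_of_nat[OF K])
    have int: "\<sigma> (of_int k) = of_int k" for k
      by (cases k) (simp_all add: nat neg is_subfield_of_nat[OF K] del: of_nat_Suc)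
    have rat: "\<sigma> (of_rat q) = of_rat q" for q
    proof -
      obtain a b where q: "q = Fract a b" "b > 0" by (cases q) auto
      have "\<sigma> (of_int a * inverse (of_int b)) = of_int a * inverse (of_int b)"
        by (simp add: mult inv int D(6) is_subfield_of_int[OF K])
      then show ?thesis using q by (simp add: of_rat_rat divide_inverse)
    qed
    have poly: "poly (map_poly of_rat g) z \<in> ?K \<and>
        \<sigma> (poly (map_poly of_rat g) z) = poly (map_poly of_rat g) (\<sigma> z)"
      if z: "z \<in> ?K" for z and g :: "rat poly"
    proof (induction g)
      case 0
      then show ?case using zero D(1) by simp
    next
      case (pCons a g)
      then show ?case
        using z by (simp add: map_poly_pCons add mult rat D(3,4) is_subfield_of_rat[OF K])
    qed
    have "is_subfield {x \<in> ?K. \<sigma> x \<in> \<real>}"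
      unfolding is_subfield_def using D zero one by (auto simp: add mult neg inv)
    moreover have "z \<in> {x \<in> ?K. \<sigma> x \<in> \<real>}" if "poly (map_poly of_rat p) z = 0" for z
    proof -
      have z: "z \<in> ?K" using that by (rule root_in_splitting_field)
      then have "poly (map_poly of_rat p) (\<sigma> z) = 0" using poly[OF z, of p] that zero by simp
      then show ?thesis using R z by blast
    qed
    ultimately have "?K \<subseteq> {x \<in> ?K. \<sigma> x \<in> \<real>}"
      unfolding splitting_field_def by (intro gen_field_least) auto
    then show "\<forall>x\<in>?K. \<sigma> x \<in> \<real>" by blast
  qed
qed

section \<open>Roots of quadratics and cubics\<close>

lemma complex_quadratic_root: "\<exists>z::complex. z ^ 2 + p * z + r = 0"
proof
  show "((- p + csqrt (p ^ 2 - 4 * r)) / 2) ^ 2 + p * ((- p + csqrt (p ^ 2 - 4 * r)) / 2) + r = 0"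
  proof -
    define s where "s = csqrt (p ^ 2 - 4 * r)"
    have "s ^ 2 = p ^ 2 - 4 * r" by (simp add: s_def)
    moreover have "((- p + s) / 2) ^ 2 + p * ((- p + s) / 2) + r = (s ^ 2 - (p ^ 2 - 4 * r)) / 4"
      by (simp add: field_simps power2_eq_square)
    ultimately show ?thesis unfolding s_def[symmetric] by simp
  qed
qed

text \<open>Vieta's relations are the form in which the roots of a cubic are passed on; this turns
  them into values of the cubic, both at its roots and at 2 and -2.\<close>

lemma cubic_eq_prod:
  fixes y :: "'a :: comm_ring_1"
  assumes "a = - (y1 + y2 + y3)" "b = y1 * y2 + y1 * y3 + y2 * y3" "c = - (y1 * y2 * y3)"
  shows "y ^ 3 + a * y ^ 2 + b * y + c = (y - y1) * (y - y2) * (y - y3)"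
  unfolding assms by (simp add: algebra_simps power2_eq_square power3_eq_cube)

lemma complex_cubic_vieta:
  fixes a b c :: complex
  obtains y1 y2 y3 where "a = - (y1 + y2 + y3)" "b = y1 * y2 + y1 * y3 + y2 * y3"
    "c = - (y1 * y2 * y3)"
proof -
  have "\<not> constant (poly [:c, b, a, 1:])" by (simp add: constant_degree)
  then obtain y1 where y1: "poly [:c, b, a, 1:] y1 = 0"
    using fundamental_theorem_of_algebra by blast
  obtain y2 where y2: "y2 ^ 2 + (a + y1) * y2 + (b + y1 * (a + y1)) = 0"
    using complex_quadratic_root by blast
  define y3 where "y3 = - a - y1 - y2"
  have b: "b = - (y2 ^ 2) - (a + y1) * y2 - y1 * (a + y1)" using y2 by algebra
  have c: "c = - (y1 ^ 3) - a * y1 ^ 2 - b * y1"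
    using y1 by simp algebra
  show thesis
  proof (rule that[of y1 y2 y3])
    show "a = - (y1 + y2 + y3)" by (simp add: y3_def)
    show "b = y1 * y2 + y1 * y3 + y2 * y3"
      by (simp add: y3_def b algebra_simps power2_eq_square)
    show "c = - (y1 * y2 * y3)"
      unfolding c b y3_def by (simp add: algebra_simps power2_eq_square power3_eq_cube)
  qed
qed

text \<open>The quadratic cofactor of \<open>y1\<close> has coefficients \<open>p\<close> and
  \<open>r\<close>, and the discriminant of the cubic is \<open>p ^ 2 - 4 * r\<close> times the
  square of the cofactor's value at \<open>y1\<close>. If \<open>p ^ 2 - 4 * r\<close> were
  negative, that value would be positive and the discriminant negative.\<close>

lemma real_cubic_vieta:
  fixes a b c :: real
  assumes disc: "18 * a * b * c - 4 * a ^ 3 * c + a ^ 2 * b ^ 2 - 4 * b ^ 3 - 27 * c ^ 2 \<ge> 0"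
    and y1: "y1 ^ 3 + a * y1 ^ 2 + b * y1 + c = 0"
  obtains y2 y3 where "a = - (y1 + y2 + y3)" "b = y1 * y2 + y1 * y3 + y2 * y3"
    "c = - (y1 * y2 * y3)"
proof -
  define p where "p = a + y1"
  define r where "r = b + y1 * p"
  have a: "a = p - y1" and b: "b = r - y1 * p" by (simp_all add: p_def r_def)
  have c: "c = - (y1 * r)"
    using y1 unfolding a b by (simp add: algebra_simps power2_eq_square power3_eq_cube)
  have "(p ^ 2 - 4 * r) * (y1 ^ 2 + p * y1 + r) ^ 2 =
      18 * a * b * c - 4 * a ^ 3 * c + a ^ 2 * b ^ 2 - 4 * b ^ 3 - 27 * c ^ 2"
    unfolding a b c by algebra
  then have *: "(p ^ 2 - 4 * r) * (y1 ^ 2 + p * y1 + r) ^ 2 \<ge> 0" using disc by simp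
  have "p ^ 2 - 4 * r \<ge> 0"
  proof (rule ccontr)
    assume neg: "\<not> p ^ 2 - 4 * r \<ge> 0"
    have "y1 ^ 2 + p * y1 + r = (y1 + p / 2) ^ 2 - (p ^ 2 - 4 * r) / 4"
      by (simp add: field_simps power2_eq_square)
    then have "y1 ^ 2 + p * y1 + r > 0" using neg by (smt (verit) zero_le_power2 divide_neg_pos)
    then show False using * neg by (simp add: zero_le_mult_iff)
  qed
  define s where "s = sqrt (p ^ 2 - 4 * r)"
  have "s ^ 2 = p ^ 2 - 4 * r" unfolding s_def using \<open>p ^ 2 - 4 * r \<ge> 0\<close> by simp
  then have r: "r = (p ^ 2 - s ^ 2) / 4" by simp
  show thesis
    by (rule that[of "(- p + s) / 2" "(- p - s) / 2"])
      (simp_all add: a b c r field_simps power2_eq_square)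
qed

text \<open>The negative value at 2 gives a root \<open>y1\<close> above 2. The signs at 2 and -2
  then put the other two roots on the same side of each of these points, and since their sum
  \<open>- a - y1\<close> is below -4, that side is the left one.\<close>

lemma real_cubic_roots_ge_2:
  fixes a b c :: real
  assumes disc: "18 * a * b * c - 4 * a ^ 3 * c + a ^ 2 * b ^ 2 - 4 * b ^ 3 - 27 * c ^ 2 \<ge> 0"
    and g2: "8 + 4 * a + 2 * b + c < 0" and gm2: "- 8 + 4 * a - 2 * b + c < 0" and a: "a \<ge> 2"
  obtains y1 y2 y3 where "a = - (y1 + y2 + y3)" "b = y1 * y2 + y1 * y3 + y2 * y3"
    "c = - (y1 * y2 * y3)" "y1 > 2" "y2 < -2" "y3 < -2"
proof -
  define g where "g = [:c, b, a, 1:]"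
  have ev: "poly g y = y ^ 3 + a * y ^ 2 + b * y + c" for y
    by (simp add: g_def algebra_simps power2_eq_square power3_eq_cube)
  obtain n where n: "\<And>x. x \<ge> n \<Longrightarrow> poly g x \<ge> lead_coeff g"
    using poly_pinfty_gt_lc[of g] by (auto simp: g_def)
  \<comment> \<open>The maximum with 3 keeps the right endpoint of the interval beyond 2.\<close>
  have "poly g (max n 3) > 0" using n[of "max n 3"] by (simp add: g_def)
  moreover have "poly g 2 < 0" using g2 by (simp add: ev)
  moreover have "2 < max n 3" by simp
  ultimately obtain y1 where y1: "y1 > 2" "poly g y1 = 0"
    using poly_IVT_pos[of 2 "max n 3" g] by blast
  obtain y2 y3 where v: "a = - (y1 + y2 + y3)" "b = y1 * y2 + y1 * y3 + y2 * y3"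
    "c = - (y1 * y2 * y3)"
    using real_cubic_vieta[OF disc] y1(2) unfolding ev by blast
  have "(2 - y1) * ((2 - y2) * (2 - y3)) < 0"
    using cubic_eq_prod[OF v, of 2] g2 by (simp add: mult.assoc)
  then have p: "(2 - y2) * (2 - y3) > 0" using y1(1) by (simp add: mult_less_0_iff)
  have "(-2 - y1) * ((-2 - y2) * (-2 - y3)) < 0"
    using cubic_eq_prod[OF v, of "-2"] gm2 by (simp add: mult.assoc)
  then have m: "(-2 - y2) * (-2 - y3) > 0" using y1(1) by (simp add: mult_less_0_iff)
  have "y2 + y3 < -4" using v(1) a y1(1) by simp
  then have "y2 < -2 \<and> y3 < -2" using p m unfolding zero_less_mult_iff by linarith
  then show thesis using that v y1(1) by blast
qed

section \<open>Signs of the quintic\<close>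

text \<open>The P of the outline. It is polymorphic because identities in \<open>t\<close> live over
  the rationals, while the comparison with \<open>r\<close> takes place over the reals.\<close>

definition quintic :: "'a::comm_ring_1 \<Rightarrow> 'a" where
  "quintic x = 7 * x^5 - 10 * x^4 - 20 * x^3 - 4"

lemma of_rat_quintic: "of_rat (quintic t) = quintic (of_rat t :: 'a::field_char_0)"
  by (simp add: quintic_def of_rat_diff of_rat_mult of_rat_power)

lemma quintic_neg:
  fixes x :: real
  assumes "x \<le> 2"
  shows "quintic x < 0"
proof (cases "x \<ge> 0")
  case True
  \<comment> \<open>The right-hand side expands to \<open>8 - (7 * x^2 - 10 * x)\<close>, which is
    more than the bound 20 asks for.\<close>
  have "0 \<le> 7 * x * (2 - x) + (2 - x) * 4" using True assms by simp
  then have "7 * x^2 - 10 * x - 20 \<le> 0"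
    using assms by (simp add: algebra_simps power2_eq_square)
  then have "x^3 * (7 * x^2 - 10 * x - 20) \<le> 0" using True by (simp add: mult_nonneg_nonpos)
  moreover have "quintic x = x^3 * (7 * x^2 - 10 * x - 20) - 4"
    by (simp add: quintic_def algebra_simps eval_nat_numeral)
  ultimately show ?thesis by simp
next
  case False
  define s where "s = - x"
  have s: "s > 0" using False by (simp add: s_def)
  \<comment> \<open>The local maximum of the quintic at -6/7 is -100/2401, which is why the cofactor below has to be exact.\<close>
  have "quintic x = - ((s - 6/7)^2 * (7 * s^3 + 22 * s^2 + 88/7 * s + 264/49) + 100/2401)"
    unfolding quintic_def s_def by (simp add: field_simps eval_nat_numeral)
  moreover have "(s - 6/7)^2 * (7 * s^3 + 22 * s^2 + 88/7 * s + 264/49) \<ge> 0"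
    using s by (intro mult_nonneg_nonneg) auto
  ultimately show ?thesis by linarith
qed

text \<open>P + 4 is the product of \<open>x^3\<close> and a quadratic \<open>h\<close> that
  increases from 2 on. The bound -4 says precisely that \<open>h x\<close> is nonnegative, so both
  factors grow without a change of sign.\<close>

lemma quintic_strict_increasing:
  fixes x y :: real
  assumes "2 \<le> x" "x < y" "quintic x \<ge> -4"
  shows "quintic x < quintic y"
proof -
  define h where "h z = 7 * z^2 - 10 * z - 20" for z :: real
  have quintic: "quintic z = z^3 * h z - 4" for z :: real
    by (simp add: quintic_def h_def algebra_simps eval_nat_numeral)
  have "h y - h x = (y - x) * (7 * (x + y) - 10)"
    by (simp add: h_def algebra_simps power2_eq_square)
  then have hlt: "h x < h y" using assms(1,2) by (smt (verit) mult_pos_pos)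
  have hy: "h y \<ge> 0" using assms hlt by (simp add: quintic zero_le_mult_iff)
  have pow: "x ^ 3 < y ^ 3" using assms by (intro power_strict_mono) auto
  have "x ^ 3 * h x < x ^ 3 * h y" using hlt assms(1) by (intro mult_strict_left_mono) auto
  also have "\<dots> \<le> y ^ 3 * h y" using pow hy by (intro mult_right_mono) auto
  finally show ?thesis by (simp add: quintic)
qed

text \<open>The bound 5/2 is chosen because it is the limit of the parameters 2 + p/(2p+1) used for
  the second claim.\<close>

lemma quintic_root_gt:
  fixes r :: real
  assumes "quintic r = 0"
  shows "5 / 2 < r"
proof (rule ccontr)
  assume "\<not> 5 / 2 < r"
  moreover have "quintic (5/2 :: real) < 0" by (simp add: quintic_def eval_nat_numeral)
  moreover have "r > 2" using quintic_neg[of r] assms by force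
  ultimately show False
    using quintic_strict_increasing[of r "5/2"] assms by (cases "r = 5/2") auto
qed

lemma quintic_neg_iff:
  fixes x r :: real
  assumes "quintic r = 0"
  shows "quintic x < 0 \<longleftrightarrow> x < r"
proof
  assume neg: "quintic x < 0"
  show "x < r"
    using quintic_strict_increasing[of r x] quintic_root_gt[OF assms] assms neg
    by (cases x r rule: linorder_cases) auto
next
  assume x: "x < r"
  show "quintic x < 0"
  proof (rule ccontr)
    assume "\<not> quintic x < 0"
    then show False
      using quintic_neg[of x] quintic_strict_increasing[of x r] assms x by force
  qed
qed

text \<open>Parity descent: in a root a/b in lowest terms, \<open>a\<close> is even, and after
  division by 4 so is \<open>b\<close>. This makes the inequality between t and the sign of P
  strict.\<close>

lemma quintic_rat_nonzero: "quintic (t :: rat) \<noteq> 0"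
proof
  assume P0: "quintic t = 0"
  obtain a b where t: "t = Fract a b" "b > 0" "coprime a b" by (cases t)
  then have t': "t = of_int a / of_int b" by (simp add: Fract_of_int_quotient)
  have "(of_int (7 * a^5 - 10 * a^4 * b - 20 * a^3 * b^2 - 4 * b^5) :: rat) = of_int b ^ 5 * quintic t"
    using t(2) unfolding t' quintic_def by (simp add: field_simps eval_nat_numeral)
  then have eq: "7 * a^5 = 10 * a^4 * b + 20 * a^3 * b^2 + 4 * b^5"
    unfolding P0 by (simp only: mult_zero_right of_int_eq_0_iff)
  then have "even (7 * a^5)" by simp
  then have "even a" by simp
  then obtain c where c: "a = 2 * c" by blast
  have "b ^ 5 = 2 * (28 * c^5 - 20 * c^4 * b - 20 * c^3 * b^2)"
    using eq unfolding c by (simp add: power_mult_distrib)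
  then have "even (b ^ 5)" by simp
  then have "even b" by simp
  with \<open>even a\<close> t(3) show False by (auto dest: coprime_common_divisor)
qed

section \<open>The cubic in y = x + 1/x and its values\<close>

definition den :: "rat \<Rightarrow> rat" where "den t = t^2 + t - 1"

text \<open>The form \<open>a^2 + a * b - b^2\<close> is odd unless \<open>a\<close> and
  \<open>b\<close> are both even.\<close>

lemma den_nonzero: "den t \<noteq> 0"
proof
  assume q0: "den t = 0"
  obtain a b where t: "t = Fract a b" "b > 0" "coprime a b" by (cases t)
  then have t': "t = of_int a / of_int b" by (simp add: Fract_of_int_quotient)
  have "(of_int (a^2 + a * b - b^2) :: rat) = of_int b ^ 2 * den t"
    using t(2) unfolding t' den_def by (simp add: field_simps power2_eq_square)
  then have "a^2 + a * b - b^2 = 0"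
    unfolding q0 by (simp only: mult_zero_right of_int_eq_0_iff)
  then have "even (a^2 + a * b - b^2)" by simp
  then have "even a \<and> even b" by auto
  with t(3) show False by (auto dest: coprime_common_divisor)
qed

text \<open>These are the lower coefficients of G: dividing f by x^3 and inserting x^2 + 1/x^2 = y^2
  - 2 and x^3 + 1/x^3 = y^3 - 3y leaves y^3 + u y^2 + (v - 3) y + (w - 2u).\<close>

definition cubic_c1 :: "rat \<Rightarrow> rat" where "cubic_c1 t = v_t t - 3"
definition cubic_c0 :: "rat \<Rightarrow> rat" where "cubic_c0 t = w_t t - 2 * u_t t"

lemma poly_f_t:
  fixes x :: "'a :: field_char_0"
  assumes "x \<noteq> 0" and y: "y = x + 1 / x"
  shows "poly (map_poly of_rat (f_t t)) x =
    x ^ 3 * (y ^ 3 + of_rat (u_t t) * y ^ 2 + of_rat (cubic_c1 t) * y + of_rat (cubic_c0 t))"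
proof -
  define U V W :: 'a where "U = of_rat (u_t t)" and "V = of_rat (v_t t)" and "W = of_rat (w_t t)"
  have xy: "x * y = x ^ 2 + 1"
    using assms(1) by (simp add: y distrib_left power2_eq_square)
  have "poly (map_poly of_rat (f_t t)) x =
      1 + U * x + V * x ^ 2 + W * x ^ 3 + V * x ^ 4 + U * x ^ 5 + x ^ 6"
    by (simp add: f_t_def map_poly_pCons U_def V_def W_def algebra_simps eval_nat_numeral)
  \<comment> \<open>Regrouping by powers of x^2 + 1, which equals \<open>x * y\<close>, avoids
    division by \<open>x\<close>.\<close>
  also have "\<dots> = (x * y) ^ 3 + U * x * (x * y) ^ 2 + (V - 3) * x ^ 2 * (x * y) + (W - 2 * U) * x ^ 3"
    unfolding xy by algebra
  also have "\<dots> = x ^ 3 * (y ^ 3 + U * y ^ 2 + (V - 3) * y + (W - 2 * U))" by algebra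
  finally show ?thesis
    by (simp add: U_def V_def W_def cubic_c1_def cubic_c0_def of_rat_diff of_rat_mult)
qed

text \<open>With the common denominator \<open>D\<close> multiplied out once and for all, the values
  and the discriminant of G reduce to polynomial identities in \<open>t\<close>.\<close>

lemma coeffs_cleared:
  assumes "t \<noteq> 2"
  defines "D \<equiv> (t - 2) * den t ^ 2"
  shows "D * u_t t = (3*t^2 - 2*t + 2) * (t - 2) * (t^2 + t - 1)"
    and "D * cubic_c1 t = (t^5 - 5*t^4 + 10*t^3 - 20*t^2 + 15*t - 7) - 3 * (t - 2) * (t^2 + t - 1)^2"
    and "D * cubic_c0 t = (-3*t^5 + 10*t^4 - 20*t^3 + 20*t^2 - 20*t + 6)
      - 2 * (3*t^2 - 2*t + 2) * (t - 2) * (t^2 + t - 1)"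
proof -
  note nz = den_nonzero[of t]
  show u: "D * u_t t = (3*t^2 - 2*t + 2) * (t - 2) * (t^2 + t - 1)"
    using nz unfolding D_def u_t_def den_def[symmetric] by (simp add: power2_eq_square)
  have v: "D * v_t t = t^5 - 5*t^4 + 10*t^3 - 20*t^2 + 15*t - 7"
    using nz assms(1) unfolding D_def v_t_def den_def[symmetric] by simp
  have w: "D * w_t t = -3*t^5 + 10*t^4 - 20*t^3 + 20*t^2 - 20*t + 6"
    using nz assms(1) unfolding D_def w_t_def den_def[symmetric] by simp
  show "D * cubic_c1 t = (t^5 - 5*t^4 + 10*t^3 - 20*t^2 + 15*t - 7) - 3 * (t - 2) * (t^2 + t - 1)^2"
    unfolding cubic_c1_def right_diff_distrib v by (simp add: D_def den_def)
  show "D * cubic_c0 t = (-3*t^5 + 10*t^4 - 20*t^3 + 20*t^2 - 20*t + 6)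
      - 2 * (3*t^2 - 2*t + 2) * (t - 2) * (t^2 + t - 1)"
    unfolding cubic_c0_def right_diff_distrib w using u by (simp add: algebra_simps)
qed

text \<open>Where \<open>den t\<close> is positive this yields u \<ge> 2, so the roots of G have sum
  at most -2.\<close>

lemma u_t_minus_2: "u_t t - 2 = (t - 2) ^ 2 / den t"
proof -
  have "(u_t t - 2) * den t = (3*t^2 - 2*t + 2) - 2 * (t^2 + t - 1)"
    using den_nonzero[of t] unfolding u_t_def den_def[symmetric] by (simp add: left_diff_distrib)
  also have "\<dots> = (t - 2) ^ 2" by (simp add: algebra_simps power2_eq_square)
  finally show ?thesis using den_nonzero[of t] by (simp add: field_simps)
qed

lemma cubic_at_2:
  assumes "t \<noteq> 2"
  shows "8 + 4 * u_t t + 2 * cubic_c1 t + cubic_c0 t = quintic t / ((t - 2) * den t ^ 2)"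
proof -
  define D where "D = (t - 2) * den t ^ 2"
  have "D * (8 + 4 * u_t t + 2 * cubic_c1 t + cubic_c0 t) = 8 * D + 4 * (D * u_t t) + 2 * (D * cubic_c1 t) + D * cubic_c0 t"
    by (simp add: algebra_simps)
  also have "\<dots> = quintic t"
    unfolding D_def coeffs_cleared[OF assms] unfolding quintic_def den_def by algebra
  finally show ?thesis using assms den_nonzero[of t] unfolding D_def by (simp add: field_simps)
qed

lemma cubic_at_minus_2:
  assumes "t \<noteq> 2"
  shows "- 8 + 4 * u_t t - 2 * cubic_c1 t + cubic_c0 t = - ((t - 2) ^ 4 / den t ^ 2)"
proof -
  define D where "D = (t - 2) * den t ^ 2"
  have "D * (- 8 + 4 * u_t t - 2 * cubic_c1 t + cubic_c0 t) =
      - 8 * D + 4 * (D * u_t t) - 2 * (D * cubic_c1 t) + D * cubic_c0 t"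
    by (simp add: algebra_simps)
  \<comment> \<open>\<open>D\<close> carries a factor \<open>t - 2\<close> that the denominator of
    G(-2) lacks; it is kept apart so that it can be cancelled.\<close>
  also have "\<dots> = (t - 2) * - ((t - 2) ^ 4)"
    unfolding D_def coeffs_cleared[OF assms] unfolding den_def by algebra
  finally have "(t - 2) * (den t ^ 2 * (- 8 + 4 * u_t t - 2 * cubic_c1 t + cubic_c0 t)) = (t - 2) * - ((t - 2) ^ 4)"
    unfolding D_def by (simp only: mult.assoc)
  then have "den t ^ 2 * (- 8 + 4 * u_t t - 2 * cubic_c1 t + cubic_c0 t) = - ((t - 2) ^ 4)"
    by (rule iffD1[OF mult_left_cancel, rotated]) (use assms in simp)
  then show ?thesis using den_nonzero[of t] by (simp add: field_simps)
qed

text \<open>The discriminant is homogeneous of degree 4 in the coefficients 1, a, b, c, so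
  \<open>D ^ 4\<close> clears all denominators.\<close>

lemma cubic_disc:
  fixes t :: rat
  assumes "t \<noteq> 2"
  defines "D \<equiv> (t - 2) * den t ^ 2" and "a \<equiv> u_t t" and "b \<equiv> cubic_c1 t" and "c \<equiv> cubic_c0 t"
  shows "D ^ 4 * (18 * a * b * c - 4 * a ^ 3 * c + a ^ 2 * b ^ 2 - 4 * b ^ 3 - 27 * c ^ 2) =
    - 25 * ((t - 2) * quintic t) * (t^7 - 3*t^6 - 3*t^5 + 10*t^4 - 7*t^2 + t + 1) ^ 2"
proof -
  have "D ^ 4 * (18 * a * b * c - 4 * a ^ 3 * c + a ^ 2 * b ^ 2 - 4 * b ^ 3 - 27 * c ^ 2) =
    18 * D * (D * a) * (D * b) * (D * c) - 4 * (D * a) ^ 3 * (D * c) + (D * a) ^ 2 * (D * b) ^ 2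
    - 4 * D * (D * b) ^ 3 - 27 * D ^ 2 * (D * c) ^ 2"
    by algebra
  also have "\<dots> = - 25 * ((t - 2) * quintic t) * (t^7 - 3*t^6 - 3*t^5 + 10*t^4 - 7*t^2 + t + 1) ^ 2"
    unfolding a_def b_def c_def D_def coeffs_cleared[OF assms(1)] unfolding quintic_def den_def by algebra
  finally show ?thesis .
qed

section \<open>When all roots of \<open>f_t\<close> are real\<close>

lemma of_rat_complex_eq_of_real: "(of_rat x :: complex) = of_real (of_rat x)"
proof (cases x)
  case (Fract a b)
  then show ?thesis by (simp add: of_rat_rat)
qed

lemma trace_cubic_root:
  fixes y :: complex
  assumes "y ^ 3 + of_rat (u_t t) * y ^ 2 + of_rat (cubic_c1 t) * y + of_rat (cubic_c0 t) = 0"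
  obtains x where "x \<noteq> 0" "y = x + 1 / x" "poly (map_poly of_rat (f_t t)) x = 0"
proof -
  obtain x where x: "x ^ 2 + (- y) * x + 1 = 0" using complex_quadratic_root by blast
  then have x0: "x \<noteq> 0" by auto
  have "x * y = x ^ 2 + 1" using x by algebra
  then have y: "y = x + 1 / x" using x0 by (simp add: field_simps power2_eq_square)
  show thesis
    using that[OF x0 y] poly_f_t[OF x0 y, of t] assms by simp
qed

text \<open>\<open>z\<close> solves a real quadratic with discriminant \<eta>^2 - 4 \<ge> 0, and
  \<open>s\<close> is half the square root of that discriminant.\<close>

lemma in_Reals_if_sum_inverse_real:
  fixes z :: complex
  assumes z: "z \<noteq> 0" "z + 1 / z = of_real \<eta>" and \<eta>: "\<eta> ^ 2 \<ge> 4"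
  shows "z \<in> \<real>"
proof -
  define s where "s = sqrt (\<eta> ^ 2 / 4 - 1)"
  have "s ^ 2 = \<eta> ^ 2 / 4 - 1" unfolding s_def using \<eta> by simp
  then have s: "(of_real s :: complex) ^ 2 = of_real \<eta> ^ 2 / 4 - 1"
    by (metis of_real_1 of_real_diff of_real_divide of_real_numeral of_real_power)
  have "z ^ 2 + 1 = z * of_real \<eta>"
    using z(1) unfolding z(2)[symmetric] by (simp add: distrib_left power2_eq_square)
  moreover have "(z - of_real \<eta> / 2) ^ 2 = (z ^ 2 + 1 - z * of_real \<eta>) + (of_real \<eta> ^ 2 / 4 - 1)"
    by (simp add: power2_eq_square field_simps)
  ultimately have "(z - of_real \<eta> / 2) ^ 2 = of_real s ^ 2"
    unfolding s by simp
  then have "z - of_real \<eta> / 2 = of_real s \<or> z - of_real \<eta> / 2 = - of_real s"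
    by (simp only: power2_eq_iff)
  then have "z = of_real (\<eta> / 2 + s) \<or> z = of_real (\<eta> / 2 - s)"
    by (auto simp: algebra_simps)
  then show ?thesis by (metis Reals_of_real)
qed

lemma all_roots_real_imp:
  assumes t: "t \<noteq> 2"
    and real: "\<And>z::complex. poly (map_poly of_rat (f_t t)) z = 0 \<Longrightarrow> z \<in> \<real>"
  shows "(t - 2) * quintic t < 0"
proof -
  obtain y1 y2 y3 where v: "of_rat (u_t t) = - (y1 + y2 + y3 :: complex)"
    "of_rat (cubic_c1 t) = y1 * y2 + y1 * y3 + y2 * y3" "of_rat (cubic_c0 t) = - (y1 * y2 * y3)"
    by (rule complex_cubic_vieta)
  have root: "\<exists>\<rho>::real. y = of_real \<rho> \<and> (\<rho> \<le> -2 \<or> 2 \<le> \<rho>)" if "y \<in> {y1, y2, y3}" for y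
  proof -
    have "y ^ 3 + of_rat (u_t t) * y ^ 2 + of_rat (cubic_c1 t) * y + of_rat (cubic_c0 t) = 0"
      using cubic_eq_prod[OF v, of y] that by auto
    then obtain x where x: "x \<noteq> 0" "y = x + 1 / x" "poly (map_poly of_rat (f_t t)) x = 0"
      by (rule trace_cubic_root)
    obtain \<xi> where \<xi>: "x = of_real \<xi>" using real[OF x(3)] by (auto elim: Reals_cases)
    have "\<xi> \<noteq> 0" using x(1) \<xi> by auto
    have "(\<xi> + 1 / \<xi>) ^ 2 = 2 ^ 2 + (\<xi> - 1 / \<xi>) ^ 2"
      using \<open>\<xi> \<noteq> 0\<close> by (simp add: power2_eq_square field_simps)
    then have "(\<xi> + 1 / \<xi>) ^ 2 \<ge> 2 ^ 2" by simp
    then have "\<bar>2\<bar> \<le> \<bar>\<xi> + 1 / \<xi>\<bar>" by (simp only: abs_le_square_iff)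
    then have "\<xi> + 1 / \<xi> \<le> -2 \<or> 2 \<le> \<xi> + 1 / \<xi>" by linarith
    moreover have "y = of_real (\<xi> + 1 / \<xi>)" by (simp add: x(2) \<xi>)
    ultimately show ?thesis by blast
  qed
  obtain \<rho>1 where \<rho>1: "y1 = of_real \<rho>1" "\<rho>1 \<le> -2 \<or> 2 \<le> \<rho>1" using root[of y1] by auto
  obtain \<rho>2 where \<rho>2: "y2 = of_real \<rho>2" "\<rho>2 \<le> -2 \<or> 2 \<le> \<rho>2" using root[of y2] by auto
  obtain \<rho>3 where \<rho>3: "y3 = of_real \<rho>3" "\<rho>3 \<le> -2 \<or> 2 \<le> \<rho>3" using root[of y3] by auto
  have w: "of_rat (u_t t) = - (\<rho>1 + \<rho>2 + \<rho>3)"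
    "of_rat (cubic_c1 t) = \<rho>1 * \<rho>2 + \<rho>1 * \<rho>3 + \<rho>2 * \<rho>3" "of_rat (cubic_c0 t) = - (\<rho>1 * \<rho>2 * \<rho>3)"
    using v unfolding \<rho>1(1) \<rho>2(1) \<rho>3(1) of_rat_complex_eq_of_real
    unfolding of_real_add[symmetric] of_real_mult[symmetric] of_real_minus[symmetric] of_real_eq_iff
    by simp_all
  have "(-2 - \<rho>1) * (-2 - \<rho>2) * (-2 - \<rho>3) =
      of_rat (- 8 + 4 * u_t t - 2 * cubic_c1 t + cubic_c0 t)"
    using cubic_eq_prod[OF w, of "-2"] by (simp add: of_rat_add of_rat_diff of_rat_mult of_rat_minus)
  also have "\<dots> < 0"
    unfolding cubic_at_minus_2[OF t] of_rat_less_0_iff using t den_nonzero[of t] by simp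
  finally have m: "(-2 - \<rho>1) * (-2 - \<rho>2) * (-2 - \<rho>3) < 0" .
  have "of_rat (quintic t / ((t - 2) * den t ^ 2)) = (2 - \<rho>1) * (2 - \<rho>2) * (2 - \<rho>3)"
    using cubic_eq_prod[OF w, of 2] unfolding cubic_at_2[OF t, symmetric]
    by (simp add: of_rat_add of_rat_diff of_rat_mult)
  \<comment> \<open>For a root outside the open interval from -2 to 2, its differences from 2 and
    from -2 never have opposite signs. The three factors at -2 are nonzero by \<open>m\<close>, so
    the sign there passes to 2, though only weakly.\<close>
  also have "\<dots> \<le> 0"
    using m \<rho>1(2) \<rho>2(2) \<rho>3(2) by (auto simp: mult_less_0_iff mult_le_0_iff zero_less_mult_iff zero_le_mult_iff)
  finally have "quintic t / ((t - 2) * den t ^ 2) \<le> 0" by (simp only: of_rat_le_0_iff)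
  then have "quintic t / ((t - 2) * den t ^ 2) * ((t - 2) ^ 2 * den t ^ 2) \<le> 0"
    by (intro mult_nonpos_nonneg) simp_all
  moreover have "quintic t / ((t - 2) * den t ^ 2) * ((t - 2) ^ 2 * den t ^ 2) = (t - 2) * quintic t"
    using t den_nonzero[of t] by (simp add: power2_eq_square)
  ultimately show ?thesis using quintic_rat_nonzero[of t] t by (simp add: order_le_less)
qed

lemma all_roots_real_if:
  assumes t: "t > 2" "quintic t < 0" and z: "poly (map_poly of_rat (f_t t)) z = 0"
  shows "(z :: complex) \<in> \<real>"
proof -
  have t2: "t \<noteq> 2" using t by simp
  define a b c :: real where "a = of_rat (u_t t)" and "b = of_rat (cubic_c1 t)" and "c = of_rat (cubic_c0 t)"
  have D: "((t - 2) * den t ^ 2) ^ 4 > 0" using t2 den_nonzero[of t] by simp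
  have "(t - 2) * quintic t \<le> 0" using t by (simp add: mult_le_0_iff)
  then have "- 25 * ((t - 2) * quintic t) \<ge> 0" by linarith
  then have "- 25 * ((t - 2) * quintic t) * (t^7 - 3*t^6 - 3*t^5 + 10*t^4 - 7*t^2 + t + 1) ^ 2 \<ge> 0"
    by (rule mult_nonneg_nonneg) simp
  then have "18 * u_t t * cubic_c1 t * cubic_c0 t - 4 * u_t t ^ 3 * cubic_c0 t + u_t t ^ 2 * cubic_c1 t ^ 2
      - 4 * cubic_c1 t ^ 3 - 27 * cubic_c0 t ^ 2 \<ge> 0"
    unfolding cubic_disc[OF t2, symmetric] using D by (simp only: zero_le_mult_iff) auto
  then have "(of_rat (18 * u_t t * cubic_c1 t * cubic_c0 t - 4 * u_t t ^ 3 * cubic_c0 t + u_t t ^ 2 * cubic_c1 t ^ 2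
      - 4 * cubic_c1 t ^ 3 - 27 * cubic_c0 t ^ 2) :: real) \<ge> 0"
    by (simp only: zero_le_of_rat_iff)
  then have disc: "18 * a * b * c - 4 * a ^ 3 * c + a ^ 2 * b ^ 2 - 4 * b ^ 3 - 27 * c ^ 2 \<ge> 0"
    by (simp add: a_def b_def c_def of_rat_add of_rat_diff of_rat_mult of_rat_power)
  have "8 + 4 * u_t t + 2 * cubic_c1 t + cubic_c0 t < 0"
    unfolding cubic_at_2[OF t2] using t den_nonzero[of t] by (simp add: divide_less_0_iff zero_less_mult_iff)
  then have "(of_rat (8 + 4 * u_t t + 2 * cubic_c1 t + cubic_c0 t) :: real) < 0" by (simp only: of_rat_less_0_iff)
  then have g2: "8 + 4 * a + 2 * b + c < 0"
    by (simp add: a_def b_def c_def of_rat_add of_rat_mult)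
  have "- 8 + 4 * u_t t - 2 * cubic_c1 t + cubic_c0 t < 0"
    unfolding cubic_at_minus_2[OF t2] using t2 den_nonzero[of t] by simp
  then have "(of_rat (- 8 + 4 * u_t t - 2 * cubic_c1 t + cubic_c0 t) :: real) < 0" by (simp only: of_rat_less_0_iff)
  then have gm2: "- 8 + 4 * a - 2 * b + c < 0"
    by (simp add: a_def b_def c_def of_rat_add of_rat_diff of_rat_mult of_rat_minus)
  \<comment> \<open>Expansion around 2 shows positivity for \<open>t > 2\<close>.\<close>
  have "den t = (t - 2) ^ 2 + (5 * (t - 2) + 5)" by (simp add: den_def algebra_simps power2_eq_square)
  moreover have "5 * (t - 2) + 5 > 0" using t(1) by simp
  ultimately have "den t > 0" by (simp add: add_nonneg_pos)
  then have "(t - 2) ^ 2 / den t \<ge> 0" by simp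
  then have "u_t t \<ge> 2" using u_t_minus_2[of t] by simp
  then have a2: "a \<ge> 2" unfolding a_def by (metis of_rat_less_eq of_rat_numeral_eq)
  obtain y1 y2 y3 where v: "a = - (y1 + y2 + y3)" "b = y1 * y2 + y1 * y3 + y2 * y3"
    "c = - (y1 * y2 * y3)" and y: "y1 > 2" "y2 < -2" "y3 < -2"
    by (rule real_cubic_roots_ge_2[OF disc g2 gm2 a2])
  have z0: "z \<noteq> 0" using z by (auto simp: f_t_def map_poly_pCons)
  have v': "of_rat (u_t t) = - (of_real y1 + of_real y2 + of_real y3 :: complex)"
    "of_rat (cubic_c1 t) = (of_real y1 * of_real y2 + of_real y1 * of_real y3 + of_real y2 * of_real y3 :: complex)"
    "of_rat (cubic_c0 t) = - (of_real y1 * of_real y2 * of_real y3 :: complex)"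
    using v unfolding a_def b_def c_def of_rat_complex_eq_of_real by simp_all
  have "(z + 1 / z - of_real y1) * (z + 1 / z - of_real y2) * (z + 1 / z - of_real y3) = 0"
    using poly_f_t[OF z0 refl, of t] z z0 unfolding cubic_eq_prod[OF v'] by simp
  then obtain \<eta> where \<eta>: "\<eta> \<in> {y1, y2, y3}" "z + 1 / z = of_real \<eta>" by auto
  have "\<bar>2\<bar> \<le> \<bar>\<eta>\<bar>" using \<eta>(1) y by auto
  then have "\<eta> ^ 2 \<ge> 2 ^ 2" by (simp only: abs_le_square_iff)
  then show ?thesis using in_Reals_if_sum_inverse_real[OF z0 \<eta>(2)] by simp
qed

text \<open>To the left of 2 both \<open>t - 2\<close> and P are negative, so a negative product
  leaves only \<open>2 < t\<close> with P(t) < 0, and the latter means t < r.\<close>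

lemma totally_real_K_t_iff:
  assumes r: "quintic r = (0 :: real)" and t: "t \<noteq> 2"
  shows "totally_real (K_t t) \<longleftrightarrow> 2 < t \<and> of_rat t < r"
proof -
  have quintic: "quintic t < 0 \<longleftrightarrow> of_rat t < r"
    unfolding quintic_neg_iff[OF r, symmetric] of_rat_quintic[symmetric] by simp
  have "t > 2" if "(t - 2) * quintic t < 0"
  proof (rule ccontr)
    assume "\<not> t > 2"
    then have "quintic t > 0" using that t by (simp add: mult_less_0_iff)
    moreover have "(of_rat t :: real) < 2"
      using \<open>\<not> t > 2\<close> t by (metis of_rat_less of_rat_numeral_eq linorder_neqE)
    ultimately show False using quintic quintic_root_gt[OF r] by simp
  qed
  then have *: "(t - 2) * quintic t < 0 \<longleftrightarrow> 2 < t \<and> quintic t < 0" by (auto simp: mult_less_0_iff)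
  show ?thesis
    unfolding K_t_def totally_real_splitting_field_iff quintic[symmetric]
    using all_roots_real_imp[OF t] all_roots_real_if[of t] * by blast
qed

section \<open>A square root in \<open>K_t\<close> and the finite dimension of
  \<open>K_t\<close>\<close>

lemma sqrt_in_K_t:
  assumes t: "t \<noteq> 2"
  obtains s where "s \<in> K_t t" "s ^ 2 = of_rat (- ((t - 2) * quintic t))"
proof -
  have K: "is_subfield (K_t t)" unfolding K_t_def splitting_field_def by (rule is_subfield_gen_field)
  obtain y1 y2 y3 where v: "of_rat (u_t t) = - (y1 + y2 + y3 :: complex)"
    "of_rat (cubic_c1 t) = y1 * y2 + y1 * y3 + y2 * y3" "of_rat (cubic_c0 t) = - (y1 * y2 * y3)"
    by (rule complex_cubic_vieta)
  have root: "\<exists>d\<in>K_t t. d ^ 2 = y ^ 2 - 4" if "y \<in> {y1, y2, y3}" for y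
  proof -
    have "y ^ 3 + of_rat (u_t t) * y ^ 2 + of_rat (cubic_c1 t) * y + of_rat (cubic_c0 t) = 0"
      using cubic_eq_prod[OF v, of y] that by auto
    then obtain x where x: "x \<noteq> 0" "y = x + 1 / x" "poly (map_poly of_rat (f_t t)) x = 0"
      by (rule trace_cubic_root)
    have "x \<in> K_t t" unfolding K_t_def by (rule root_in_splitting_field[OF x(3)])
    then have "x - 1 / x \<in> K_t t"
      by (intro is_subfield_diff[OF K] is_subfield_divide[OF K] is_subfieldD(2)[OF K])
    moreover have "(x - 1 / x) ^ 2 = y ^ 2 - 4"
      using x(1) unfolding x(2) by (simp add: power2_eq_square field_simps)
    ultimately show ?thesis by blast
  qed
  obtain d1 where d1: "d1 \<in> K_t t" "d1 ^ 2 = y1 ^ 2 - 4" using root[of y1] by auto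
  obtain d2 where d2: "d2 \<in> K_t t" "d2 ^ 2 = y2 ^ 2 - 4" using root[of y2] by auto
  obtain d3 where d3: "d3 \<in> K_t t" "d3 ^ 2 = y3 ^ 2 - 4" using root[of y3] by auto
  \<comment> \<open>G(2)G(-2) equals -(t-2)^3 P(t) / d^4; the factor k^2 reduces it to
    -(t-2)P(t).\<close>
  define k where "k = den t ^ 2 / (t - 2)"
  have "(d1 * d2 * d3) ^ 2 = (y1 ^ 2 - 4) * (y2 ^ 2 - 4) * (y3 ^ 2 - 4)"
    by (simp add: power_mult_distrib d1 d2 d3)
  \<comment> \<open>Each y^2 - 4 splits as (2 - y)(-2 - y), which turns the product into
    G(2)G(-2).\<close>
  also have "\<dots> = ((2 - y1) * (2 - y2) * (2 - y3)) * ((-2 - y1) * (-2 - y2) * (-2 - y3))" by algebra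
  also have "(2 - y1) * (2 - y2) * (2 - y3) = of_rat (8 + 4 * u_t t + 2 * cubic_c1 t + cubic_c0 t)"
    using cubic_eq_prod[OF v, of 2] by (simp add: of_rat_add of_rat_mult mult.commute)
  also have "(-2 - y1) * (-2 - y2) * (-2 - y3) = of_rat (- 8 + 4 * u_t t - 2 * cubic_c1 t + cubic_c0 t)"
    using cubic_eq_prod[OF v, of "-2"] by (simp add: of_rat_add of_rat_diff of_rat_mult of_rat_minus mult.commute)
  finally have "(of_rat k * (d1 * d2 * d3)) ^ 2 =
      of_rat (k ^ 2 * (quintic t / ((t - 2) * den t ^ 2) * - ((t - 2) ^ 4 / den t ^ 2)))"
    unfolding cubic_at_2[OF t] cubic_at_minus_2[OF t] power_mult_distrib
    by (simp only: of_rat_mult of_rat_power)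
  also have "k ^ 2 * (quintic t / ((t - 2) * den t ^ 2) * - ((t - 2) ^ 4 / den t ^ 2)) = - ((t - 2) * quintic t)"
  proof -
    have "k ^ 2 * (quintic t / (m * Q ^ 2) * - (m ^ 4 / Q ^ 2)) = - (m * quintic t)"
      if "k = Q ^ 2 / m" "m \<noteq> 0" "Q \<noteq> 0" for m Q :: rat
      using that(2,3) unfolding that(1) by (simp add: field_simps eval_nat_numeral)
    then show ?thesis using t den_nonzero[of t] unfolding k_def by auto
  qed
  finally have "(of_rat k * (d1 * d2 * d3)) ^ 2 = of_rat (- ((t - 2) * quintic t))" .
  moreover have "of_rat k * (d1 * d2 * d3) \<in> K_t t"
    by (intro is_subfieldD(4)[OF K] is_subfield_of_rat[OF K] d1 d2 d3)
  ultimately show thesis using that by blast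
qed

text \<open>As f is monic of degree 6, its negated lower coefficients \<open>cf\<close> express the
  sixth power of each root. The roots then lie in a finite-dimensional subfield, which contains the
  least subfield \<open>K_t t\<close>.\<close>

lemma K_t_finite_dim:
  obtains B where "finite B" "K_t t \<subseteq> Q.span B"
proof -
  let ?A = "{z. poly (map_poly of_rat (f_t t)) z = (0::complex)}"
  define cf where "cf i = - coeff (f_t t) i" for i
  have eq: "z ^ 6 = (\<Sum>i<6. of_rat (cf i) * z ^ i)" if "z \<in> ?A" for z :: complex
  proof -
    define U V W :: complex where "U = of_rat (u_t t)" and "V = of_rat (v_t t)" and "W = of_rat (w_t t)"
    have "1 + U * z + V * z ^ 2 + W * z ^ 3 + V * z ^ 4 + U * z ^ 5 + z ^ 6 = 0"
      using that by (simp add: f_t_def map_poly_pCons U_def V_def W_def algebra_simps eval_nat_numeral)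
    moreover have "(\<Sum>i<6. of_rat (cf i) * z ^ i) =
        - 1 - U * z - V * z ^ 2 - W * z ^ 3 - V * z ^ 4 - U * z ^ 5"
      by (simp add: cf_def f_t_def eval_nat_numeral lessThan_Suc of_rat_minus U_def V_def W_def)
    ultimately show ?thesis by algebra
  qed
  have "finite ?A"
    by (intro poly_roots_finite) (auto simp: f_t_def map_poly_pCons)
  then obtain F B where "is_subfield F" "?A \<subseteq> F" "finite B" "F \<subseteq> Q.span B"
    using algebraic_in_finite_dim_subfield[of ?A 6 cf] eq by auto
  then show thesis
    using that gen_field_least unfolding K_t_def splitting_field_def by (meson order_trans)
qed

section \<open>Infinitely many fields from prime parameters\<close>

text \<open>The fraction is below 1/2, which keeps the parameter below r, and it contains
  \<open>p\<close> exactly once, since 2p+1 is prime to \<open>p\<close>.\<close>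

definition t_of_prime :: "nat \<Rightarrow> rat" where
  "t_of_prime p = 2 + of_nat p / (2 * of_nat p + 1)"

text \<open>The representative (2p+1)^6 * -(t-2)P(t) of the discriminant's square class at t = 2 + p/(2p+1).\<close>
definition disc_rep :: "int \<Rightarrow> int" where
  "disc_rep p = p * (100 * (2*p+1)^5 - 200 * p^2 * (2*p+1)^3 - 180 * p^3 * (2*p+1)^2 - 60 * p^4 * (2*p+1) - 7 * p^5)"

lemma t_of_prime_bounds: "p > 0 \<Longrightarrow> 2 < t_of_prime p" "t_of_prime p < 5 / 2"
  by (auto simp: t_of_prime_def field_simps)

text \<open>The sixth power clears the denominators of a polynomial of degree 6 and, being even,
  preserves the square class.\<close>

lemma disc_rep_eq: "of_int (disc_rep (int p)) = (2 * of_nat p + 1) ^ 6 * - ((t_of_prime p - 2) * quintic (t_of_prime p))"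
proof -
  have *: "k ^ 6 * - ((2 + x / k - 2) * quintic (2 + x / k)) =
      x * (100 * k^5 - 200 * x^2 * k^3 - 180 * x^3 * k^2 - 60 * x^4 * k - 7 * x^5)"
    if "k \<noteq> 0" for x k :: rat
  proof -
    define e where "e = x / k"
    have x: "x = k * e" using that by (simp add: e_def)
    show ?thesis unfolding e_def[symmetric] unfolding x quintic_def by algebra
  qed
  have "2 * of_nat p + 1 \<noteq> (0 :: rat)" by (simp add: add_nonneg_eq_0_iff)
  from *[OF this, of "of_nat p"] show ?thesis unfolding t_of_prime_def disc_rep_def by simp
qed

text \<open>The cofactor of \<open>p\<close> is congruent to -P(2) = 100 modulo \<open>p\<close>,
  and a prime above 5 does not divide 100.\<close>

lemma multiplicity_disc_rep:
  assumes p: "prime p" "p > 5"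
  shows "multiplicity (int p) (disc_rep (int p)) = 1" "disc_rep (int p) \<noteq> 0"
proof -
  let ?x = "int p"
  define M where "M = 100 * (2*?x+1)^5 - 200 * ?x^2 * (2*?x+1)^3 - 180 * ?x^3 * (2*?x+1)^2
    - 60 * ?x^4 * (2*?x+1) - 7 * ?x^5"
  have "\<exists>c. M = 100 + ?x * c"
  proof
    show "M = 100 + ?x * (100 * (32*?x^4 + 80*?x^3 + 80*?x^2 + 40*?x + 10) - 200 * ?x * (2*?x+1)^3
      - 180 * ?x^2 * (2*?x+1)^2 - 60 * ?x^3 * (2*?x+1) - 7 * ?x^4)"
      unfolding M_def by algebra
  qed
  moreover have "\<not> ?x dvd 100"
  proof
    assume "?x dvd 100"
    then have "p dvd 2 ^ 2 * 5 ^ 2" using int_dvd_int_iff[of p 100] by simp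
    then have "p dvd 2 \<or> p dvd 5"
      using p(1) by (metis prime_dvd_mult_iff prime_dvd_power)
    then show False using p(2) by (auto dest!: dvd_imp_le)
  qed
  ultimately have nd: "\<not> ?x dvd M" by (metis dvd_add_left_iff dvd_triv_left)
  have N: "disc_rep ?x = ?x * M" by (simp add: disc_rep_def M_def)
  have pr: "prime ?x" using p(1) by simp
  have "M \<noteq> 0" using nd by auto
  then show "disc_rep ?x \<noteq> 0" using p(2) by (simp add: N)
  have "multiplicity ?x (?x * M) = Suc (multiplicity ?x M)"
    using \<open>M \<noteq> 0\<close> pr by (intro multiplicity_times_same) auto
  then show "multiplicity ?x (disc_rep ?x) = 1"
    using nd by (simp add: N not_dvd_imp_multiplicity_0)
qed

text \<open>After the denominator of \<open>q\<close> is cleared, both sides carry squares, which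
  change a multiplicity by an even amount.\<close>

lemma square_ratio_even_multiplicity:
  fixes m n p :: int
  assumes p: "prime p" and nz: "m \<noteq> 0" "n \<noteq> 0" and q: "(of_int m :: rat) = q ^ 2 * of_int n"
  shows "even (multiplicity p m) \<longleftrightarrow> even (multiplicity p n)"
proof -
  obtain a b where t: "q = Fract a b" "b > 0" "coprime a b" by (cases q)
  then have q': "q = of_int a / of_int b" by (simp add: Fract_of_int_quotient)
  have "(of_int (m * b ^ 2) :: rat) = of_int (a ^ 2 * n)"
    using q t(2) unfolding q' by (simp add: field_simps)
  then have eq: "m * b ^ 2 = a ^ 2 * n" by (simp only: of_int_eq_iff)
  then have "a \<noteq> 0" using nz t(2) by auto
  have pe: "prime_elem p" using p by (rule prime_imp_prime_elem)
  have "multiplicity p (m * b ^ 2) = multiplicity p m + 2 * multiplicity p b"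
    using nz t(2) pe by (simp add: prime_elem_multiplicity_mult_distrib prime_elem_multiplicity_power_distrib)
  moreover have "multiplicity p (a ^ 2 * n) = 2 * multiplicity p a + multiplicity p n"
    using nz \<open>a \<noteq> 0\<close> pe by (simp add: prime_elem_multiplicity_mult_distrib prime_elem_multiplicity_power_distrib)
  ultimately have "even (multiplicity p m + 2 * multiplicity p b) \<longleftrightarrow>
      even (2 * multiplicity p a + multiplicity p n)"
    using eq by simp
  then show ?thesis by simp
qed

text \<open>Infinitely many primes with the same field would share finitely many square classes. By
  pigeonhole, infinitely many of them lie in the class of one \<open>p0\<close>, and the
  multiplicity of a suitable \<open>p\<close> separates two members of that class.\<close>

lemma finite_primes_same_K_t:
  "finite {p. prime p \<and> p > 5 \<and> K_t (t_of_prime p) = K}"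
proof (rule ccontr)
  define A where "A = {p. prime p \<and> p > 5 \<and> K_t (t_of_prime p) = K}"
  assume "infinite {p. prime p \<and> p > 5 \<and> K_t (t_of_prime p) = K}"
  then have inf: "infinite A" by (simp add: A_def)
  then obtain p1 where "p1 \<in> A" using infinite_imp_nonempty by blast
  then have K1: "K = K_t (t_of_prime p1)" by (simp add: A_def)
  obtain B where B: "finite B" "K \<subseteq> Q.span B" unfolding K1 by (rule K_t_finite_dim)
  obtain C where C: "finite C"
    "\<And>s. s \<in> K \<Longrightarrow> s ^ 2 \<in> \<rat> \<Longrightarrow> \<exists>q\<in>\<rat>. \<exists>c\<in>C. s = q * c"
    by (rule finite_square_classes[OF B], rule that, assumption, blast)
  have "\<exists>q c. c \<in> C \<and> of_int (disc_rep (int p)) = (of_rat q * c) ^ 2" if p: "p \<in> A" for p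
  proof -
    have "t_of_prime p \<noteq> 2" using p t_of_prime_bounds(1)[of p] by (auto simp: A_def)
    then obtain s where s: "s \<in> K_t (t_of_prime p)" "s ^ 2 = of_rat (- ((t_of_prime p - 2) * quintic (t_of_prime p)))"
      by (rule sqrt_in_K_t)
    have "s \<in> K" "s ^ 2 \<in> \<rat>" using p s by (auto simp: A_def)
    then obtain q c where c: "s = q * c" "q \<in> \<rat>" "c \<in> C" using C(2)[of s] by blast
    obtain q' where q': "q = of_rat q'" using c(2) by (auto elim: Rats_cases)
    define k :: rat where "k = 2 * of_nat p + 1"
    have "(of_int (disc_rep (int p)) :: complex) = of_rat (of_int (disc_rep (int p)))" by simp
    also have "\<dots> = of_rat (k ^ 6) * s ^ 2" unfolding disc_rep_eq s(2) k_def by (simp only: of_rat_mult)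
    also have "\<dots> = (of_rat (k ^ 3 * q') * c) ^ 2"
      unfolding c(1) q' by (simp add: of_rat_mult of_rat_power power_mult_distrib flip: power_mult)
    finally show ?thesis using c(3) by blast
  qed
  then obtain Q C' where QC: "\<And>p. p \<in> A \<Longrightarrow> C' p \<in> C"
    "\<And>p. p \<in> A \<Longrightarrow> of_int (disc_rep (int p)) = (of_rat (Q p) * C' p) ^ 2" by metis
  have "C' ` A \<subseteq> C" using QC(1) by blast
  then have "finite (C' ` A)" using C(1) finite_subset by blast
  then obtain p0 where p0: "p0 \<in> A" "infinite {p \<in> A. C' p = C' p0}"
    using pigeonhole_infinite[OF inf] by blast
  have N0: "disc_rep (int p0) \<noteq> 0" using p0(1) multiplicity_disc_rep(2) by (simp add: A_def)
  \<comment> \<open>A nonzero integer has finitely many divisors, so some prime in the infinite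
    class does not divide the representative of \<open>p0\<close>.\<close>
  then have "finite {d. d dvd disc_rep (int p0)}" by (rule finite_divisors_int)
  then have "finite (int -` {d. d dvd disc_rep (int p0)})" by (intro finite_vimageI) auto
  then have "\<not> {p \<in> A. C' p = C' p0} \<subseteq> int -` {d. d dvd disc_rep (int p0)}"
    using p0(2) finite_subset by metis
  then obtain p where p: "p \<in> A" "C' p = C' p0" "\<not> int p dvd disc_rep (int p0)" by blast
  have mult: "multiplicity (int p) (disc_rep (int p)) = 1" "disc_rep (int p) \<noteq> 0" "prime (int p)"
    using p(1) multiplicity_disc_rep by (auto simp: A_def)
  have "Q p0 \<noteq> 0" using QC(2)[OF p0(1)] N0 by auto
  \<comment> \<open>The common class representative \<open>C' p = C' p0\<close> cancels, leaving a
    rational square as the ratio.\<close>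
  have "(of_rat (of_int (disc_rep (int p))) :: complex) = of_rat ((Q p / Q p0) ^ 2 * of_int (disc_rep (int p0)))"
    using QC(2)[OF p(1)] QC(2)[OF p0(1)] \<open>Q p0 \<noteq> 0\<close> p(2)
    by (simp add: of_rat_mult of_rat_divide of_rat_power power_mult_distrib power_divide)
  then have "(of_int (disc_rep (int p)) :: rat) = (Q p / Q p0) ^ 2 * of_int (disc_rep (int p0))"
    by (simp only: of_rat_eq_iff)
  from square_ratio_even_multiplicity[OF mult(3,2) N0 this]
  show False using mult(1) not_dvd_imp_multiplicity_0[OF p(3)] by simp
qed

theorem theorem2:
  fixes r :: real
  assumes "7 * r^5 - 10 * r^4 - 20 * r^3 - 4 = 0"
  shows "(\<forall>t::rat. t \<noteq> 2 \<longrightarrow>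
            (totally_real (K_t t) \<longleftrightarrow> 2 < t \<and> of_rat t < r))
       \<and> (\<exists>S :: rat set. infinite S \<and> (\<forall>t\<in>S. 2 < t \<and> of_rat t < r) \<and> inj_on K_t S)"
proof (intro conjI allI impI)
  have r: "quintic r = 0" using assms by (simp add: quintic_def)
  show "totally_real (K_t t) \<longleftrightarrow> 2 < t \<and> of_rat t < r" if "t \<noteq> 2" for t
    by (rule totally_real_K_t_iff[OF r that])
  define A where "A = {p::nat. prime p \<and> p > 5}"
  have "A = {p. prime p} - {..5}" by (auto simp: A_def)
  then have inf: "infinite A" using primes_infinite by simp
  \<comment> \<open>Each field comes from finitely many primes only, so infinitely many primes
    produce infinitely many fields.\<close>
  have "infinite ((\<lambda>p. K_t (t_of_prime p)) ` A)"
  proof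
    assume "finite ((\<lambda>p. K_t (t_of_prime p)) ` A)"
    then obtain p0 where "infinite {p \<in> A. K_t (t_of_prime p) = K_t (t_of_prime p0)}"
      using pigeonhole_infinite[OF inf] by blast
    then show False
      using finite_primes_same_K_t[of "K_t (t_of_prime p0)"] by (simp add: A_def conj_assoc)
  qed
  then have "infinite (K_t ` t_of_prime ` A)" by (simp add: image_image)
  \<comment> \<open>\<open>S\<close> selects one parameter for each field that occurs, which makes
    \<open>K_t\<close> injective on it.\<close>
  moreover obtain S where S: "S \<subseteq> t_of_prime ` A" "inj_on K_t S" "K_t ` S = K_t ` t_of_prime ` A"
    by (metis subset_image_inj order_refl)
  ultimately have "infinite S" using finite_imageI by metis
  moreover have "2 < t \<and> of_rat t < r" if "t \<in> S" for t
  proof -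
    have "t \<in> t_of_prime ` A" using that S(1) by blast
    then obtain p where p: "p \<in> A" "t = t_of_prime p" by blast
    have "(of_rat t :: real) < of_rat (5 / 2)" unfolding of_rat_less p(2) by (rule t_of_prime_bounds(2))
    also have "\<dots> = 5 / 2" by (simp add: of_rat_divide)
    finally show ?thesis using quintic_root_gt[OF r] t_of_prime_bounds(1)[of p] p by (auto simp: A_def)
  qed
  ultimately show "\<exists>S. infinite S \<and> (\<forall>t\<in>S. 2 < t \<and> of_rat t < r) \<and> inj_on K_t S"
    using S(2) by blast
qed

end
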